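(* For every integer $g$ there exists a bipartite cubic graph of girth at least $g$ whose strong chromatic index is at least $6$.
   Context: A strong edge coloring of a graph is a proper edge coloring with no bichromatic path of length three; the strong chromatic index is the minimum number of colors in such a coloring. A cubic graph is a 3-regular graph. *)

theory Defs
  imports Main "HOL-Library.Extended_Nat"
begin

text \<open>A graph is a pair of a vertex set and a set of edges, each edge a two-element vertex set.\<close>

definition finite_simple_graph :: "'a set \<Rightarrow> 'a set set \<Rightarrow> bool" where
  "finite_simple_graph V E \<longleftrightarrow> finite V \<and> (\<forall>e\<in>E. e \<subseteq> V \<and> card e = 2)"

definition degree :: "'a set set \<Rightarrow> 'a \<Rightarrow> nat" where
  "degree E v = card {e \<in> E. v \<in> e}"

definition regular :: "nat \<Rightarrow> 'a set \<Rightarrow> 'a set set \<Rightarrow> bool" where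
  "regular k V E \<longleftrightarrow> (\<forall>v\<in>V. degree E v = k)"

abbreviation cubic :: "'a set \<Rightarrow> 'a set set \<Rightarrow> bool" where
  "cubic \<equiv> regular 3"

definition bipartite :: "'a set \<Rightarrow> 'a set set \<Rightarrow> bool" where
  "bipartite V E \<longleftrightarrow>
     (\<exists>X Y. X \<union> Y = V \<and> X \<inter> Y = {} \<and> (\<forall>e\<in>E. \<exists>x\<in>X. \<exists>y\<in>Y. e = {x, y}))"

fun path_edges :: "'a list \<Rightarrow> 'a set list" where
  "path_edges (x # y # zs) = {x, y} # path_edges (y # zs)"
| "path_edges _ = []"

text \<open>Paths have pairwise distinct vertices; their length is the number of edges.\<close>

definition is_path :: "'a set \<Rightarrow> 'a set set \<Rightarrow> 'a list \<Rightarrow> bool" where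
  "is_path V E xs \<longleftrightarrow>
     xs \<noteq> [] \<and> set xs \<subseteq> V \<and> distinct xs \<and> set (path_edges xs) \<subseteq> E"

text \<open>A cycle is the list of its vertices, without repeating the first one at the end, so its
  number of edges is the length of the list.\<close>

definition is_cycle :: "'a set \<Rightarrow> 'a set set \<Rightarrow> 'a list \<Rightarrow> bool" where
  "is_cycle V E xs \<longleftrightarrow> is_path V E xs \<and> 3 \<le> length xs \<and> {last xs, hd xs} \<in> E"

text \<open>The girth of an acyclic graph is \<open>\<infinity>\<close>.\<close>

definition girth :: "'a set \<Rightarrow> 'a set set \<Rightarrow> enat" where
  "girth V E = (INF xs \<in> {xs. is_cycle V E xs}. enat (length xs))"

definition proper_edge_coloring :: "'a set set \<Rightarrow> ('a set \<Rightarrow> 'c) \<Rightarrow> bool" where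
  "proper_edge_coloring E c \<longleftrightarrow>
     (\<forall>e\<in>E. \<forall>f\<in>E. e \<noteq> f \<and> e \<inter> f \<noteq> {} \<longrightarrow> c e \<noteq> c f)"

definition bichromatic :: "('a set \<Rightarrow> 'c) \<Rightarrow> 'a list \<Rightarrow> bool" where
  "bichromatic c xs \<longleftrightarrow> card (c ` set (path_edges xs)) = 2"

definition strong_edge_coloring :: "'a set \<Rightarrow> 'a set set \<Rightarrow> ('a set \<Rightarrow> 'c) \<Rightarrow> bool" where
  "strong_edge_coloring V E c \<longleftrightarrow>
     proper_edge_coloring E c \<and>
     \<not> (\<exists>xs. is_path V E xs \<and> length (path_edges xs) = 3 \<and> bichromatic c xs)"

text \<open>For finite graphs the minimum is attained, since an injective coloring is strong.\<close>

definition strong_chromatic_index :: "'a set \<Rightarrow> 'a set set \<Rightarrow> nat" where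
  "strong_chromatic_index V E =
     (LEAST k. \<exists>c :: 'a set \<Rightarrow> nat. strong_edge_coloring V E c \<and> c ` E \<subseteq> {..<k})"

end

theory Submission
  imports Defs "HOL-Library.Z2" "HOL-Library.Numeral_Type"
begin

text \<open>In a cubic graph every edge has a closed neighbourhood of five edges, on which a strong edge
  coloring is injective. With five colors, each color class is therefore a perfect code of edges, so
  5 divides the number of edges and hence the number of vertices. It remains to find bipartite cubic
  graphs of large girth whose order is a power of two. They come from three involutions that act
  without short reduced relations on a set of size a power of two: multiplication by \<open>1 + X\<^sub>i\<close>
  on noncommutative polynomials over the two-element field with \<open>X\<^sub>i\<^sup>2 = 0\<close>, truncated in
  high degree. As in Magnus' embedding of the free group, the coefficient at
  \<open>X\<^sub>i X\<^sub>j \<dots> X\<^sub>k\<close> of the product \<open>(1 + X\<^sub>i) (1 + X\<^sub>j) \<dots> (1 + X\<^sub>k)\<close> is 1 for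
  every reduced word. Doubling the set by a side makes the graph bipartite.\<close>

section \<open>Strong colorings with five colors\<close>

lemma strong_edge_coloring_adjacent:
  assumes "strong_edge_coloring V E c" "e \<in> E" "f \<in> E" "e \<noteq> f" "e \<inter> f \<noteq> {}"
  shows "c e \<noteq> c f"
  using assms unfolding strong_edge_coloring_def proper_edge_coloring_def by blast

text \<open>If the outer edges shared a color, properness would give the middle edge another one, so
  the path would show exactly two colors.\<close>

lemma strong_edge_coloring_path3:
  assumes "strong_edge_coloring V E c" and "\<Union>E \<subseteq> V" and "distinct [u, v, w, x]"
    and "{u, v} \<in> E" "{v, w} \<in> E" "{w, x} \<in> E"
  shows "c {u, v} \<noteq> c {w, x}"
proof
  assume eq: "c {u, v} = c {w, x}"
  have "c {u, v} \<noteq> c {v, w}"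
    using assms by (intro strong_edge_coloring_adjacent[OF assms(1)]) (auto simp: doubleton_eq_iff)
  then have "bichromatic c [u, v, w, x]"
    by (auto simp: bichromatic_def eq card_insert_if)
  moreover have "is_path V E [u, v, w, x]"
    using assms by (auto simp: is_path_def)
  ultimately show False
    using assms(1) unfolding strong_edge_coloring_def by fastforce
qed

lemma finite_simple_graph_finite_edges:
  assumes "finite_simple_graph V E"
  shows "finite E"
proof -
  have "E \<subseteq> Pow V" using assms unfolding finite_simple_graph_def by blast
  then show ?thesis using assms unfolding finite_simple_graph_def by (meson finite_Pow_iff finite_subset)
qed

text \<open>Two disjoint edges that meet \<open>e\<close> contain different ends of
  \<open>e\<close>, so they are the outer edges of a path of length three with \<open>e\<close> in
  the middle.\<close>

lemma inj_on_closed_neighbourhood: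
  assumes G: "finite_simple_graph V E" and c: "strong_edge_coloring V E c" and e: "e \<in> E"
  shows "inj_on c {f \<in> E. f \<inter> e \<noteq> {}}"
proof (rule inj_onI, rule ccontr)
  fix f f' assume f: "f \<in> {f \<in> E. f \<inter> e \<noteq> {}}" and f': "f' \<in> {f \<in> E. f \<inter> e \<noteq> {}}"
    and eq: "c f = c f'" and ne: "f \<noteq> f'"
  have disj: "f \<inter> f' = {}"
    using strong_edge_coloring_adjacent[OF c] f f' eq ne by blast
  obtain v w where v: "v \<in> f" "v \<in> e" and w: "w \<in> f'" "w \<in> e"
    using f f' by blast
  have two: "\<And>d. d \<in> E \<Longrightarrow> card d = 2" and sub: "\<Union>E \<subseteq> V"
    using G unfolding finite_simple_graph_def by auto
  have pair: "\<exists>y. d = {x, y} \<and> x \<noteq> y" if "d \<in> E" "x \<in> d" for d x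
    using two[OF that(1)] that(2) by (auto simp: card_2_iff)
  obtain u where u: "f = {v, u}" "v \<noteq> u" using pair f v by blast
  obtain x where x: "f' = {w, x}" "w \<noteq> x" using pair f' w by blast
  have "v \<noteq> w" using disj v w by blast
  then have "e = {v, w}" using pair[OF e v(2)] w(2) by auto
  moreover have "distinct [u, v, w, x]" using u x disj by auto
  ultimately have "c {u, v} \<noteq> c {w, x}"
    using f f' e u x by (intro strong_edge_coloring_path3[OF c sub]) (auto simp: insert_commute)
  then show False using eq u x by (simp add: insert_commute)
qed

text \<open>Inclusion-exclusion gives 3 + 3 - 1: edges are sets, so only \<open>e\<close> contains
  both of its ends.\<close>

lemma card_closed_neighbourhood:
  assumes G: "finite_simple_graph V E" and "cubic V E" and e: "e \<in> E"
  shows "card {f \<in> E. f \<inter> e \<noteq> {}} = 5"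
proof -
  obtain u v where uv: "e = {u, v}" "u \<noteq> v"
    using G e unfolding finite_simple_graph_def by (meson card_2_iff)
  let ?A = "{f \<in> E. u \<in> f}" and ?B = "{f \<in> E. v \<in> f}"
  have "u \<in> V" "v \<in> V" using G e uv unfolding finite_simple_graph_def by blast+
  then have deg: "card ?A = 3" "card ?B = 3"
    using assms(2) unfolding regular_def degree_def by auto
  have "?A \<inter> ?B = {e}"
  proof -
    have "f = e" if "f \<in> E" "u \<in> f" "v \<in> f" for f
      using that G uv unfolding finite_simple_graph_def by (auto simp: card_2_iff)
    then show ?thesis using e uv(1) by blast
  qed
  moreover have "{f \<in> E. f \<inter> e \<noteq> {}} = ?A \<union> ?B" using uv by auto
  moreover have "finite ?A" "finite ?B" using finite_simple_graph_finite_edges[OF G] by auto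
  ultimately show ?thesis using card_Un_Int[of ?A ?B] deg by simp
qed

text \<open>Each closed neighbourhood contains exactly one edge of color 0. Counting pairs of an
  edge and a 0-colored edge meeting it gives five times the size of that color class.\<close>

lemma five_dvd_card_edges:
  fixes c :: "'a set \<Rightarrow> nat"
  assumes G: "finite_simple_graph V E" and cub: "cubic V E"
    and c: "strong_edge_coloring V E c" and range: "c ` E \<subseteq> {..<5}"
  shows "5 dvd card E"
proof -
  let ?N = "\<lambda>e. {f \<in> E. f \<inter> e \<noteq> {}}"
  let ?F = "{f \<in> E. c f = 0}"
  have fin: "finite E" by (rule finite_simple_graph_finite_edges[OF G])
  have one: "card {f \<in> ?F. f \<inter> e \<noteq> {}} = 1" if e: "e \<in> E" for e
  proof -
    have inj: "inj_on c (?N e)" by (rule inj_on_closed_neighbourhood[OF G c e])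
    have "c ` ?N e = {..<5}"
    proof (rule card_subset_eq)
      show "c ` ?N e \<subseteq> {..<5}" using range by auto
      show "card (c ` ?N e) = card {..<5::nat}"
        by (simp add: card_image[OF inj] card_closed_neighbourhood[OF G cub e])
    qed simp
    then have "0 \<in> c ` ?N e" by simp
    then obtain f where f: "f \<in> ?N e" "c f = 0" by (metis (no_types, lifting) imageE)
    have "h = f" if "h \<in> ?F" "h \<inter> e \<noteq> {}" for h
      by (rule inj_onD[OF inj]) (use f that in auto)
    then have "{h \<in> ?F. h \<inter> e \<noteq> {}} = {f}" using f by blast
    then show ?thesis by simp
  qed
  have "card E = (\<Sum>e\<in>E. card {f \<in> ?F. f \<inter> e \<noteq> {}})" using one by simp
  also have "\<dots> = (\<Sum>f\<in>?F. card {e \<in> E. f \<inter> e \<noteq> {}})"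
    using fin by (intro sum_multicount_gen) auto
  also have "\<dots> = (\<Sum>f\<in>?F. 5)"
    using card_closed_neighbourhood[OF G cub] by (intro sum.cong) (auto simp: Int_commute)
  finally show ?thesis by simp
qed

lemma regular_handshake:
  assumes G: "finite_simple_graph V E" and reg: "regular k V E"
  shows "2 * card E = k * card V"
proof -
  have "(\<Sum>v\<in>V. card {e \<in> E. v \<in> e}) = (\<Sum>e\<in>E. card {v \<in> V. v \<in> e})"
    using G finite_simple_graph_finite_edges[OF G] unfolding finite_simple_graph_def
    by (intro sum_multicount_gen) auto
  moreover have "{v \<in> V. v \<in> e} = e" if "e \<in> E" for e
    using that G unfolding finite_simple_graph_def by auto
  ultimately show ?thesis
    using G reg unfolding finite_simple_graph_def regular_def degree_def by (simp add: mult.commute)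
qed

section \<open>The strong chromatic index as an attained minimum\<close>

lemma length_path_edges: "length (path_edges xs) = length xs - 1"
  by (induction xs rule: path_edges.induct) auto

lemma path_edges_snoc:
  "xs \<noteq> [] \<Longrightarrow> path_edges (xs @ [y]) = path_edges xs @ [{last xs, y}]"
  by (induction xs rule: path_edges.induct) auto

lemma path_edges_length3:
  assumes "length (path_edges xs) = 3"
  obtains u v w x where "xs = [u, v, w, x]"
proof -
  have "length xs = Suc (Suc (Suc (Suc 0)))" using assms by (simp add: length_path_edges)
  then show ?thesis using that unfolding length_Suc_conv by auto
qed

lemma inj_on_imp_strong_edge_coloring:
  assumes "inj_on c E"
  shows "strong_edge_coloring V E c"
proof -
  have "\<not> bichromatic c xs" if p: "is_path V E xs" and l: "length (path_edges xs) = 3" for xs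
  proof -
    obtain u v w x where xs: "xs = [u, v, w, x]" using path_edges_length3[OF l] .
    have "card (c ` {{u, v}, {v, w}, {w, x}}) = card {{u, v}, {v, w}, {w, x}}"
      using p xs by (intro card_image inj_on_subset[OF assms]) (auto simp: is_path_def)
    also have "\<dots> = 3"
      using p xs by (auto simp: is_path_def doubleton_eq_iff card_insert_if)
    finally show ?thesis by (simp add: bichromatic_def xs)
  qed
  moreover have "proper_edge_coloring E c"
    using assms by (auto simp: proper_edge_coloring_def inj_on_def)
  ultimately show ?thesis by (auto simp: strong_edge_coloring_def)
qed

text \<open>\<open>LEAST\<close> is informative only once some number of colors works; an injective
  coloring supplies one.\<close>

lemma strong_chromatic_index_attained:
  assumes "finite E"
  obtains c :: "'a set \<Rightarrow> nat"
  where "strong_edge_coloring V E c" "c ` E \<subseteq> {..<strong_chromatic_index V E}"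
proof -
  obtain c :: "'a set \<Rightarrow> nat" and k where "inj_on c E" "c ` E = {i. i < k}"
    using finite_imp_inj_to_nat_seg[OF assms] by metis
  then have "strong_edge_coloring V E c \<and> c ` E \<subseteq> {..<k}"
    by (auto intro: inj_on_imp_strong_edge_coloring)
  then have "\<exists>k. \<exists>c :: 'a set \<Rightarrow> nat. strong_edge_coloring V E c \<and> c ` E \<subseteq> {..<k}"
    by (intro exI)
  from LeastI_ex[OF this] show ?thesis
    using that unfolding strong_chromatic_index_def by (elim exE conjE)
qed

lemma strong_chromatic_index_ge_6:
  assumes G: "finite_simple_graph V E" and cub: "cubic V E" and "\<not> 5 dvd card V"
  shows "6 \<le> strong_chromatic_index V E"
proof (rule ccontr)
  assume less: "\<not> 6 \<le> strong_chromatic_index V E"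
  obtain c :: "'a set \<Rightarrow> nat"
    where c: "strong_edge_coloring V E c" "c ` E \<subseteq> {..<strong_chromatic_index V E}"
    using strong_chromatic_index_attained[OF finite_simple_graph_finite_edges[OF G]] .
  then have "c ` E \<subseteq> {..<5}" using less by fastforce
  then have "5 dvd card E" by (rule five_dvd_card_edges[OF G cub c(1)])
  then have "5 dvd 3 * card V" using regular_handshake[OF G cub] by (metis dvd_mult)
  then show False using assms(3) by presburger
qed

section \<open>Graphs generated by involutions\<close>

text \<open>The setting is a Schreier graph of a free product of groups of order two. As generators
  are involutions, the \<open>distinct_adj\<close> words are the reduced ones; \<open>free\<close>
  controls the girth and \<open>side\<close> the bipartition.\<close>

locale involution_graph =
  fixes V :: "'v set" and side :: "'v \<Rightarrow> bool" and \<tau> :: "'i::finite \<Rightarrow> 'v \<Rightarrow> 'v" and n :: nat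
  assumes finite_vertices: "finite V"
    and closed: "v \<in> V \<Longrightarrow> \<tau> i v \<in> V"
    and involution: "v \<in> V \<Longrightarrow> \<tau> i (\<tau> i v) = v"
    and side: "v \<in> V \<Longrightarrow> side (\<tau> i v) \<noteq> side v"
    and two_le: "2 \<le> n"
    and free: "\<lbrakk>v \<in> V; distinct_adj w; w \<noteq> []; length w \<le> n\<rbrakk> \<Longrightarrow> foldr \<tau> w v \<noteq> v"
begin

definition edges :: "'v set set" where
  "edges = {{v, \<tau> i v} | v i. v \<in> V}"

section \<open>Basic properties of the generated graph\<close>

lemma edge_iff: "{u, v} \<in> edges \<longleftrightarrow> v \<in> V \<and> (\<exists>i. u = \<tau> i v)"
proof
  assume "{u, v} \<in> edges"
  then obtain x i where "x \<in> V" "{u, v} = {x, \<tau> i x}" unfolding edges_def by blast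
  then show "v \<in> V \<and> (\<exists>i. u = \<tau> i v)"
    using closed[of x i] involution[of x i] by (metis doubleton_eq_iff)
next
  assume "v \<in> V \<and> (\<exists>i. u = \<tau> i v)"
  then show "{u, v} \<in> edges" unfolding edges_def by blast
qed

text \<open>Otherwise the reduced word \<open>[i, j]\<close> would fix \<open>v\<close>;
  \<open>two_le\<close> brings this word within the scope of \<open>free\<close>.\<close>

lemma move_inj:
  assumes "v \<in> V" "\<tau> i v = \<tau> j v"
  shows "i = j"
proof (rule ccontr)
  assume "i \<noteq> j"
  then have "foldr \<tau> [i, j] v \<noteq> v" using assms(1) two_le by (intro free) auto
  then show False using involution[OF assms(1)] by (simp add: assms(2)[symmetric])
qed

lemma finite_simple_graph: "finite_simple_graph V edges"
proof -
  have "v \<noteq> \<tau> i v" if "v \<in> V" for v i using side[OF that, of i] by auto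
  then show ?thesis
    by (auto simp: finite_simple_graph_def edges_def finite_vertices closed card_insert_if)
qed

lemma bipartite: "bipartite V edges"
  unfolding bipartite_def
proof (intro exI conjI)
  show "{v \<in> V. side v} \<union> {v \<in> V. \<not> side v} = V" by auto
  show "\<forall>e\<in>edges. \<exists>x\<in>{v \<in> V. side v}. \<exists>y\<in>{v \<in> V. \<not> side v}. e = {x, y}"
  proof
    fix e assume "e \<in> edges"
    then obtain v i where "v \<in> V" "e = {v, \<tau> i v}" unfolding edges_def by blast
    then show "\<exists>x\<in>{v \<in> V. side v}. \<exists>y\<in>{v \<in> V. \<not> side v}. e = {x, y}"
      using closed[of v i] side[of v i] by (cases "side v") (auto simp: doubleton_eq_iff)
  qed
qed auto

lemma regular: "regular (CARD('i)) V edges"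
  unfolding regular_def degree_def
proof
  fix v assume v: "v \<in> V"
  have "\<exists>i. {u, \<tau> j u} = {v, \<tau> i v}" if "u \<in> V" "v = u \<or> v = \<tau> j u" for u j
    using that involution[of u j] by (metis insert_commute)
  then have "{e \<in> edges. v \<in> e} \<subseteq> range (\<lambda>i. {v, \<tau> i v})"
    unfolding edges_def by blast
  moreover have "range (\<lambda>i. {v, \<tau> i v}) \<subseteq> {e \<in> edges. v \<in> e}"
    using v unfolding edges_def by blast
  ultimately have "{e \<in> edges. v \<in> e} = range (\<lambda>i. {v, \<tau> i v})"
    by (rule subset_antisym)
  moreover have "inj (\<lambda>i. {v, \<tau> i v})"
    using move_inj[OF v] by (auto simp: inj_on_def doubleton_eq_iff)
  ultimately show "card {e \<in> edges. v \<in> e} = CARD('i)"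
    by (simp add: card_image)
qed

text \<open>Label each edge by its generator. Equal consecutive labels would undo a step, so the
  word is reduced. The first label \<open>i\<close> is kept apart for the comparison in the
  induction step.\<close>

lemma non_backtracking_walk:
  assumes "set (path_edges (x # y # zs)) \<subseteq> edges"
    and "\<And>j. Suc (Suc j) < length (x # y # zs) \<Longrightarrow> (x # y # zs) ! j \<noteq> (x # y # zs) ! Suc (Suc j)"
  shows "\<exists>i w. distinct_adj (i # w) \<and> length w = length zs \<and> y = foldr \<tau> w (last (y # zs)) \<and> x = \<tau> i y
    \<and> y \<in> V"
  using assms
proof (induction zs arbitrary: x y)
  case Nil
  then show ?case by (auto simp: edge_iff intro!: exI[of _ "[]"])
next
  case (Cons z zs)
  obtain i w where w: "distinct_adj (i # w)" "length w = length zs"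
    "z = foldr \<tau> w (last (z # zs))" "y = \<tau> i z" "z \<in> V"
    using Cons.IH[of y z] Cons.prems(1) Cons.prems(2)[of "Suc _"] by auto
  obtain j where j: "x = \<tau> j y" using Cons.prems(1) by (auto simp: edge_iff)
  have "x \<noteq> z" using Cons.prems(2)[of 0] by simp
  then have "j \<noteq> i" using involution w(4,5) j by auto
  then show ?case using w j closed
    by (intro exI[of _ j] exI[of _ "i # w"]) auto
qed

lemma girth_gt: "enat n < girth V edges"
proof -
  have "n < length xs" if xs: "is_cycle V edges xs" for xs
  proof (rule ccontr)
    assume short: "\<not> n < length xs"
    from xs have len: "3 \<le> length xs" and dist: "distinct xs"
      and ed: "set (path_edges xs) \<subseteq> edges" "{last xs, hd xs} \<in> edges"
      unfolding is_cycle_def is_path_def by auto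
    then obtain x y zs where xyz: "xs = x # y # zs"
      by (metis Suc_le_length_iff numeral_3_eq_3)
    \<comment> \<open>Repeating \<open>x\<close> at the end turns the closing edge into an ordinary
      step; the resulting word fixes \<open>x\<close>.\<close>
    let ?ys = "x # y # zs @ [x]"
    have ys: "?ys = xs @ [x]" using xyz by simp
    have "set (path_edges ?ys) \<subseteq> edges"
      unfolding ys using ed xyz by (subst path_edges_snoc) auto
    moreover have "?ys ! j \<noteq> ?ys ! Suc (Suc j)" if "Suc (Suc j) < length ?ys" for j
    proof (cases "Suc (Suc j) = length xs")
      \<comment> \<open>The vertex two steps ahead is the repeated \<open>x\<close>;
        \<open>j\<close> is nonzero because a cycle has at least three vertices.\<close>
      case True
      have j: "j < length xs" "0 < length xs" "j \<noteq> 0" using True len by linarith+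
      then have "xs ! j \<noteq> xs ! 0" using dist by (simp add: nth_eq_iff_index_eq)
      moreover have "xs ! 0 = x" by (simp add: xyz)
      ultimately show ?thesis using j(1) unfolding ys True by (simp add: nth_append)
    next
      case False
      then have "Suc (Suc j) < length xs" "j < length xs" using that unfolding ys by simp_all
      then show ?thesis using dist unfolding ys by (simp add: nth_append nth_eq_iff_index_eq)
    qed
    ultimately obtain i w where w: "distinct_adj (i # w)" "length w = length (zs @ [x])"
      "y = foldr \<tau> w (last (y # zs @ [x]))" "x = \<tau> i y" "y \<in> V"
      using non_backtracking_walk[of x y "zs @ [x]"] by blast
    have "foldr \<tau> (i # w) x \<noteq> x"
      using w closed short xyz by (intro free) auto
    then show False using w by simp
  qed
  then have "enat (Suc n) \<le> girth V edges"
    unfolding girth_def by (intro INF_greatest) (auto simp: Suc_le_eq)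
  then show ?thesis by (metis enat_ord_simps(2) lessI less_le_trans)
qed

lemma foldr_closed: "v \<in> V \<Longrightarrow> foldr \<tau> w v \<in> V"
  by (induction w) (auto intro: closed)

text \<open>Relabelling allows the graph to live on natural numbers.\<close>

lemma transport:
  assumes h: "inj_on h V"
  shows "involution_graph (h ` V) (side \<circ> inv_into V h) (\<lambda>i. h \<circ> \<tau> i \<circ> inv_into V h) n"
proof unfold_locales
  fix v and w :: "'i list" assume v: "v \<in> h ` V" and w: "distinct_adj w" "w \<noteq> []" "length w \<le> n"
  obtain u where u: "u \<in> V" "v = h u" using v by blast
  have "foldr (\<lambda>i. h \<circ> \<tau> i \<circ> inv_into V h) w (h u) = h (foldr \<tau> w u)" for w :: "'i list"
    by (induction w) (auto simp: inv_into_f_f[OF h foldr_closed[OF u(1)]])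
  then show "foldr (\<lambda>i. h \<circ> \<tau> i \<circ> inv_into V h) w v \<noteq> v"
    using free[OF u(1) w] h u foldr_closed by (auto simp: inj_on_eq_iff)
qed (use h finite_vertices two_le closed involution side in auto)

end

section \<open>Free involutions on a set of size a power of two\<close>

text \<open>These words index the surviving monomials: equal adjacent letters give a factor
  \<open>X\<^sub>i\<^sup>2 = 0\<close>, and longer words are truncated.\<close>

definition reduced_words :: "nat \<Rightarrow> 'i list set" where
  "reduced_words n = {w. distinct_adj w \<and> length w \<le> n}"

text \<open>Elements with constant term 1 of the algebra over the two-element field that is generated
  by noncommuting variables of square zero, truncated above degree \<open>n\<close>.\<close>

definition states :: "nat \<Rightarrow> ('i list \<Rightarrow> bit) set" where
  "states n = {a. a [] = 1 \<and> (\<forall>w. w \<notin> reduced_words n \<longrightarrow> a w = 0)}"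

text \<open>Left multiplication by \<open>1 + X\<^sub>i\<close>.\<close>

definition flip :: "nat \<Rightarrow> 'i \<Rightarrow> ('i list \<Rightarrow> bit) \<Rightarrow> 'i list \<Rightarrow> bit" where
  "flip n i a w = (if w \<in> reduced_words n \<and> w \<noteq> [] \<and> hd w = i then a w + a (tl w) else a w)"

text \<open>The coefficient at \<open>w\<close> of a product of noncommutative series, with one term
  per way of splitting \<open>w\<close> in two.\<close>

definition convolution :: "('i list \<Rightarrow> bit) \<Rightarrow> ('i list \<Rightarrow> bit) \<Rightarrow> 'i list \<Rightarrow> bit" where
  "convolution c a w = (\<Sum>k\<le>length w. c (take k w) * a (drop k w))"

definition unit_state :: "'i list \<Rightarrow> bit" where
  "unit_state w = of_bool (w = [])"

section \<open>Flips as left multiplications\<close>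

lemma reduced_words_take: "w \<in> reduced_words n \<Longrightarrow> take k w \<in> reduced_words n"
  using distinct_adj_appendD1[of "take k w" "drop k w"] by (auto simp: reduced_words_def)

lemma finite_reduced_words: "finite (reduced_words n :: 'i::finite list set)"
  by (rule finite_subset[OF _ finite_lists_length_le[of "UNIV :: 'i set" n]])
     (auto simp: reduced_words_def)

lemma bit_add_self [simp]: "(x::bit) + x = 0"
  by (cases x) auto

declare add_bit_eq_xor [simp del] mult_bit_eq_and [simp del]

lemma flip_in_states: "a \<in> states n \<Longrightarrow> flip n i a \<in> states n"
  by (auto simp: states_def flip_def)

text \<open>In characteristic two,
  \<open>(1 + X\<^sub>i)\<^sup>2 = 1 + X\<^sub>i\<^sup>2 = 1\<close>. On coefficients: the tail of a
  reduced word starting with \<open>i\<close> does not start with \<open>i\<close>, so a flip leaves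
  its coefficient alone.\<close>

lemma flip_involution: "flip n i (flip n i a) = a"
proof
  fix w
  show "flip n i (flip n i a) w = a w"
  proof (cases "w \<in> reduced_words n \<and> w \<noteq> [] \<and> hd w = i")
    case True
    then have "tl w = [] \<or> hd (tl w) \<noteq> i"
      by (cases w rule: remdups_adj.cases) (auto simp: reduced_words_def)
    then have "flip n i a (tl w) = a (tl w)" by (auto simp: flip_def)
    moreover have "flip n i b w = b w + b (tl w)" for b using True by (simp add: flip_def)
    ultimately show ?thesis by (simp only: add.assoc bit_add_self add_0_right)
  next
    case False
    then show ?thesis by (auto simp: flip_def)
  qed
qed

text \<open>This is associativity, \<open>((1 + X\<^sub>i) c) a = (1 + X\<^sub>i) (c a)\<close>,
  read off at one reduced word.\<close>

lemma convolution_flip: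
  assumes "w \<in> reduced_words n"
  shows "convolution (flip n i c) a w = flip n i (convolution c a) w"
proof (cases "w \<noteq> [] \<and> hd w = i")
  case True
  then obtain v where w: "w = i # v" by (cases w) auto
  \<comment> \<open>The empty prefix is split off because a flip never changes its
    coefficient.\<close>
  have rec: "convolution b a w = b [] * a w + (\<Sum>k\<le>length v. b (i # take k v) * a (drop k v))" for b
    by (simp add: convolution_def w sum.atMost_Suc_shift del: sum.atMost_Suc)
  have step: "flip n i c (i # take k v) = c (i # take k v) + c (take k v)" for k
    using reduced_words_take[OF assms, of "Suc k"] w by (simp add: flip_def)
  have "flip n i c [] = c []" by (simp add: flip_def)
  then have "convolution (flip n i c) a w = convolution c a w + convolution c a v"
    by (simp add: rec step distrib_right sum.distrib add.assoc convolution_def[of c a v])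
  then show ?thesis using assms True by (simp add: flip_def w)
next
  case False
  then have "flip n i c (take k w) = c (take k w)" for k
    by (cases w; cases k) (auto simp: flip_def)
  then show ?thesis using False by (auto simp: flip_def convolution_def)
qed

text \<open>A word acts as left multiplication by a single element, its image of 1, so freeness can
  be studied through that element.\<close>

lemma foldr_flip_eq_convolution:
  "v \<in> reduced_words n \<Longrightarrow>
    foldr (flip n) w a v = convolution (foldr (flip n) w unit_state) a v"
proof (induction w arbitrary: v)
  case Nil
  have "convolution unit_state a v = (\<Sum>k\<in>{0}. unit_state (take k v) * a (drop k v))"
    unfolding convolution_def by (rule sum.mono_neutral_right) (auto simp: unit_state_def)
  then show ?case by (simp add: unit_state_def[of "[]"])
next
  case (Cons i w)
  have "tl v \<in> reduced_words n"
    using Cons.prems by (cases v) (auto simp: reduced_words_def distinct_adj_Cons)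
  then show ?case using Cons.IH Cons.prems by (auto simp: convolution_flip flip_def[where w = v])
qed

section \<open>Leading coefficients and freeness\<close>

lemma foldr_flip_unit_long:
  "length w < length v \<Longrightarrow> foldr (flip n) w unit_state v = 0"
proof (induction w arbitrary: v)
  case (Cons i w)
  then show ?case by (auto simp: flip_def[of n i])
qed (auto simp: unit_state_def)

text \<open>At \<open>i # w\<close> the last flip adds the old coefficients of \<open>i # w\<close>
  and \<open>w\<close>: the first vanishes by degree, the second is 1 by induction.\<close>

lemma foldr_flip_unit_self:
  "w \<in> reduced_words n \<Longrightarrow> foldr (flip n) w unit_state w = 1"
proof (induction w)
  case (Cons i w)
  then have "w \<in> reduced_words n" by (auto simp: reduced_words_def distinct_adj_Cons)
  with Cons show ?case
    by (simp add: foldr_flip_unit_long flip_def[of n i])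
qed (simp add: unit_state_def)

lemma foldr_flip_Nil: "foldr (flip n) w a [] = a []"
  by (induction w) (simp_all add: flip_def[where w = "[]"])

text \<open>A shortest word in the support of \<open>u - 1\<close> is also in the support of \<open>(u - 1) a\<close>, as \<open>a\<close> has
  constant term 1.\<close>

lemma foldr_flip_free:
  assumes a: "a \<in> states n" and w: "w \<in> reduced_words n" "w \<noteq> []"
  shows "foldr (flip n) w a \<noteq> a"
proof
  assume fixed: "foldr (flip n) w a = a"
  define c where "c = foldr (flip n) w unit_state"
  define P where "P v \<longleftrightarrow> v \<in> reduced_words n \<and> v \<noteq> [] \<and> c v \<noteq> 0" for v
  have "P w" using w foldr_flip_unit_self[of w n] by (simp add: P_def c_def)
  then obtain v where v: "P v" and min: "\<And>u. P u \<Longrightarrow> length v \<le> length u"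
    using ex_has_least_nat[of P w length] by blast
  have c0: "c [] = 1" by (simp add: c_def foldr_flip_Nil unit_state_def)
  \<comment> \<open>Proper nonempty prefixes of \<open>v\<close> are shorter reduced words, so
    minimality keeps them out of the support.\<close>
  have mid: "c (take k v) = 0" if "0 < k" "k < length v" for k
    by (rule ccontr)
      (use min[of "take k v"] that v reduced_words_take[of v n k] in \<open>auto simp: P_def\<close>)
  have "a v = convolution c a v"
    using foldr_flip_eq_convolution[of v n w a] fixed v by (simp add: c_def P_def)
  also have "\<dots> = (\<Sum>k\<in>{0, length v}. c (take k v) * a (drop k v))"
    unfolding convolution_def using mid by (intro sum.mono_neutral_right) auto
  \<comment> \<open>The empty prefix contributes \<open>a v\<close>, and the full one
    \<open>c v\<close> because \<open>a [] = 1\<close>; this forces \<open>c v = 0\<close>.\<close>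
  also have "\<dots> = a v + c v"
    using v a c0 by (simp add: P_def states_def)
  finally show False using v by (simp add: P_def)
qed

text \<open>A state amounts to the set of nonempty reduced words with coefficient 1, an arbitrary
  subset of a finite set.\<close>

lemma card_states: "\<exists>k. card (states n :: ('i::finite list \<Rightarrow> bit) set) = 2 ^ k"
  and finite_states: "finite (states n :: ('i::finite list \<Rightarrow> bit) set)"
proof -
  let ?W = "reduced_words n - {[]} :: 'i list set"
  have bij: "bij_betw (\<lambda>A w. of_bool (w \<in> insert [] A) :: bit) (Pow ?W) (states n)"
  proof (rule bij_betw_byWitness[where f' = "\<lambda>a. {w. w \<noteq> [] \<and> a w = 1}"])
    show "\<forall>a\<in>states n. (\<lambda>w. of_bool (w \<in> insert [] {w. w \<noteq> [] \<and> a w = 1})) = a"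
      by (auto simp: states_def fun_eq_iff)
  qed (auto simp: states_def reduced_words_def)
  have fin: "finite ?W" using finite_reduced_words by simp
  show "\<exists>k. card (states n :: ('i list \<Rightarrow> bit) set) = 2 ^ k"
    using bij_betw_same_card[OF bij] card_Pow[OF fin] by metis
  show "finite (states n :: ('i list \<Rightarrow> bit) set)"
    using bij_betw_finite[OF bij] fin by simp
qed

text \<open>Toggling the Boolean separates the sides; a fixed pair would have a fixed first
  component.\<close>

lemma involution_graph_states:
  assumes "2 \<le> n"
  shows "involution_graph (states n \<times> UNIV) snd
    (\<lambda>i :: 'i::finite. map_prod (flip n i) Not) n"
proof unfold_locales
  fix v :: "('i list \<Rightarrow> bit) \<times> bool" and w :: "'i list"
  assume v: "v \<in> states n \<times> UNIV" and w: "distinct_adj w" "w \<noteq> []" "length w \<le> n"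
  have "fst (foldr (\<lambda>i. map_prod (flip n i) Not) w v) = foldr (flip n) w (fst v)"
    by (induction w) auto
  moreover have "foldr (flip n) w (fst v) \<noteq> fst v"
    using v w by (intro foldr_flip_free) (auto simp: reduced_words_def)
  ultimately show "foldr (\<lambda>i. map_prod (flip n i) Not) w v \<noteq> v" by metis
qed (use assms in \<open>auto simp: finite_states flip_in_states flip_involution\<close>)

theorem theorem6:
  fixes g :: int
  shows "\<exists>(V :: nat set) (E :: nat set set).
           finite_simple_graph V E \<and> bipartite V E \<and> cubic V E \<and>
           enat (nat g) \<le> girth V E \<and> 6 \<le> strong_chromatic_index V E"
proof -
  \<comment> \<open>Adding 2 ensures \<open>2 \<le> n\<close> for every \<open>g\<close>, also for
    negative ones, where \<open>nat g\<close> is 0.\<close>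
  define n where "n = nat g + 2"
  \<comment> \<open>The index type \<open>3\<close> provides three involutions, hence degree
    three.\<close>
  let ?S = "states n \<times> UNIV :: ((3 list \<Rightarrow> bit) \<times> bool) set"
  interpret S: involution_graph ?S snd "\<lambda>i. map_prod (flip n i) Not" n
    by (rule involution_graph_states) (simp add: n_def)
  obtain h :: "(3 list \<Rightarrow> bit) \<times> bool \<Rightarrow> nat" where h: "inj_on h ?S"
    using finite_imp_inj_to_nat_seg[OF S.finite_vertices] by metis
  interpret G: involution_graph "h ` ?S" "snd \<circ> inv_into ?S h"
    "\<lambda>i. h \<circ> map_prod (flip n i) Not \<circ> inv_into ?S h" n
    by (rule S.transport[OF h])
  have cub: "cubic (h ` ?S) G.edges" using G.regular by simp
  obtain k where "card (states n :: (3 list \<Rightarrow> bit) set) = 2 ^ k"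
    using card_states by blast
  then have "card (h ` ?S) = 2 ^ Suc k"
    by (simp add: card_image[OF h] card_cartesian_product)
  moreover have "coprime (5::nat) (2 ^ Suc k)"
    by (intro coprime_power_right_iff[THEN iffD2]) (simp add: coprime_iff_gcd_eq_1 gcd_nat.simps)
  ultimately have "\<not> 5 dvd card (h ` ?S)"
    by (metis coprime_absorb_left nat_dvd_1_iff_1 numeral_eq_one_iff semiring_norm(86))
  then have "6 \<le> strong_chromatic_index (h ` ?S) G.edges"
    by (rule strong_chromatic_index_ge_6[OF G.finite_simple_graph cub])
  moreover have "enat (nat g) \<le> girth (h ` ?S) G.edges"
  proof -
    have "enat (nat g) \<le> enat n" by (simp add: n_def)
    then show ?thesis using G.girth_gt by (meson less_imp_le order_trans)
  qed
  ultimately show ?thesis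
    using G.finite_simple_graph G.bipartite cub by blast
qed

end
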